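(* Let $0<|q|<1$ and let $z\in\mathbb{C}^*$ with $z\neq 1$. Then $$(zq,q/z,q^2;q^2)_\infty F_4(z,q)=\frac{1}{1-z}\sum_{k=-\infty}^{\infty}\frac{(-1)^{k-1}q^{k^2}}{1+q^{2k-1}}z^{1-k}=-\frac{1}{1-z}\sum_{k=-\infty}^{\infty}\frac{(-1)^{k-1}q^{k^2}}{1+q^{2k-1}}z^{k}=\sum_{k=1}^{\infty}\frac{(-1)^{k-1}q^{k^2}}{1+q^{2k-1}}\cdot\frac{z^{1-k}-z^{k}}{1-z}.$$
   Context: Standard $q$-Pochhammer notation: $(a;q)_0=1$, $(a;q)_n=\prod_{k=0}^{n-1}(1-aq^k)$, $(a;q)_\infty=\prod_{k\ge0}(1-aq^k)$, and $(a_1,\dots,a_m;q)_n=(a_1;q)_n\cdots(a_m;q)_n$. Define $$F_4(z,q)=\sum_{n=0}^{\infty}\frac{(-1)^n(q;-q)_{2n}\,q^{n+1}}{(zq,q/z;q^2)_{n+1}},$$ where $(q;-q)_{2n}=\prod_{k=0}^{2n-1}(1-q(-q)^k)$. *)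

theory Defs
  imports "HOL-Analysis.Analysis"
begin

definition qpoch :: "complex \<Rightarrow> complex \<Rightarrow> nat \<Rightarrow> complex" where
  "qpoch a q n = (\<Prod>k<n. 1 - a * q ^ k)"

definition qpoch_inf :: "complex \<Rightarrow> complex \<Rightarrow> complex" where
  "qpoch_inf a q = (\<Prod>k. 1 - a * q ^ k)"

text \<open>The multi-parameter symbols take the list of parameters as first argument.\<close>

definition qpochs :: "complex list \<Rightarrow> complex \<Rightarrow> nat \<Rightarrow> complex" where
  "qpochs as q n = (\<Prod>a\<leftarrow>as. qpoch a q n)"

definition qpochs_inf :: "complex list \<Rightarrow> complex \<Rightarrow> complex" where
  "qpochs_inf as q = (\<Prod>a\<leftarrow>as. qpoch_inf a q)"

definition F4_term :: "complex \<Rightarrow> complex \<Rightarrow> nat \<Rightarrow> complex" where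
  "F4_term z q n =
     (- 1) ^ n * qpoch q (- q) (2 * n) * q ^ (n + 1) / qpochs [z * q, q / z] (q ^ 2) (n + 1)"

definition F4 :: "complex \<Rightarrow> complex \<Rightarrow> complex" where
  "F4 z q = (\<Sum>n. F4_term z q n)"

text \<open>
  The points \<open>z\<close> at which every term of the series is defined. Division by zero yields zero here,
  so at the excluded points (the poles \<open>z = q powi (2 * m + 1)\<close> with \<open>m\<close> an integer) the value of
  \<open>F4\<close> is meaningless.
\<close>

definition F4_domain :: "complex \<Rightarrow> complex set" where
  "F4_domain q = {z. z \<noteq> 0 \<and> (\<forall>n. qpochs [z * q, q / z] (q ^ 2) (n + 1) \<noteq> 0)}"

definition lerch_coeff :: "complex \<Rightarrow> int \<Rightarrow> complex" where
  "lerch_coeff q k = (- 1) powi (k - 1) * q powi (k ^ 2) / (1 + q powi (2 * k - 1))"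

end

theory Submission
  imports Defs "HOL-Complex_Analysis.Complex_Analysis"
begin

text \<open>
  Multiply \<open>F4\<close> by \<open>\<theta>(z) = (zq, q/z, q^2; q^2)_inf\<close> to obtain a function \<open>G\<close> that is holomorphic on the
  punctured plane. A telescoping certificate gives \<open>(1 - z) G(z) + (1 - q^2 z) G(q^2 z) / q = \<theta>(z)\<close>.
  The bilateral sum \<open>S(z)\<close> with coefficients \<open>lerch_coeff\<close> satisfies \<open>S(z) + S(q^2 z) / q = - \<theta>(z)\<close> by the
  Jacobi triple product, so \<open>D(z) = (1 - z) G(z) + S(z)\<close> satisfies \<open>D(q^2 z) = - q D(z)\<close>, and
  Liouville's theorem forces \<open>D = 0\<close>. The other two forms of the sum follow from the antisymmetry of
  the coefficients under \<open>k \<mapsto> 1 - k\<close>, and the limit from the continuity of \<open>G\<close>.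
\<close>

subsection \<open>Infinite q-Pochhammer symbols\<close>

lemma summable_norm_geometric:
  fixes a p :: complex
  assumes "norm p < 1"
  shows "summable (\<lambda>n. norm (a * p ^ n))"
  using assms by (simp add: norm_mult norm_power summable_mult)

lemma convergent_prod_qpoch:
  fixes a p :: complex
  assumes "norm p < 1"
  shows "convergent_prod (\<lambda>k. 1 - a * p ^ k)"
proof -
  have "summable (\<lambda>k. norm ((1 - a * p ^ k) - 1))"
    using summable_norm_geometric[OF assms, of a] by simp
  then show ?thesis
    by (intro abs_convergent_prod_imp_convergent_prod summable_imp_abs_convergent_prod)
qed

lemma qpoch_LIMSEQ:
  assumes "norm p < 1"
  shows "qpoch a p \<longlonglongrightarrow> qpoch_inf a p"
proof -
  have "(\<lambda>n. \<Prod>k\<le>n. 1 - a * p ^ k) \<longlonglongrightarrow> qpoch_inf a p"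
    unfolding qpoch_inf_def by (rule convergent_prod_LIMSEQ[OF convergent_prod_qpoch[OF assms]])
  then have "(\<lambda>n. qpoch a p (Suc n)) \<longlonglongrightarrow> qpoch_inf a p"
    by (simp only: qpoch_def lessThan_Suc_atMost)
  then show ?thesis
    by (rule LIMSEQ_imp_Suc)
qed

lemma qpoch_0 [simp]: "qpoch a p 0 = 1"
  and qpoch_Suc: "qpoch a p (Suc n) = qpoch a p n * (1 - a * p ^ n)"
  by (simp_all add: qpoch_def)

lemma qpoch_add: "qpoch a p (m + n) = qpoch a p m * qpoch (a * p ^ m) p n"
  by (induction n) (simp_all add: qpoch_Suc power_add mult.assoc)

text \<open>Both sides are limits in \<open>m\<close> of the finite splitting
  \<open>qpoch_add\<close>, with the first \<open>n\<close> factors held fixed.\<close>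

lemma qpoch_inf_split:
  assumes "norm p < 1"
  shows "qpoch_inf a p = qpoch a p n * qpoch_inf (a * p ^ n) p"
proof -
  have "(\<lambda>m. qpoch a p (m + n)) \<longlonglongrightarrow> qpoch_inf a p"
    by (rule LIMSEQ_ignore_initial_segment[OF qpoch_LIMSEQ[OF assms]])
  moreover have "(\<lambda>m. qpoch a p (m + n)) \<longlonglongrightarrow> qpoch a p n * qpoch_inf (a * p ^ n) p"
    unfolding add.commute[of _ n] qpoch_add
    by (intro tendsto_mult tendsto_const qpoch_LIMSEQ assms)
  ultimately show ?thesis
    by (rule LIMSEQ_unique)
qed

lemma qpoch_inf_rec:
  assumes "norm p < 1"
  shows "qpoch_inf a p = (1 - a) * qpoch_inf (a * p) p"
  using qpoch_inf_split[OF assms, of a 1] by (simp add: qpoch_def)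

lemma qpoch_inf_nonzero:
  assumes "norm p < 1" and "\<And>k. a * p ^ k \<noteq> 1"
  shows "qpoch_inf a p \<noteq> 0"
  unfolding qpoch_inf_def
  using assms by (intro prodinf_nonzero convergent_prod_qpoch) auto

lemma qpoch_inf_nonzero_small:
  assumes "norm p < 1" and "norm a < 1"
  shows "qpoch_inf a p \<noteq> 0"
proof (rule qpoch_inf_nonzero[OF assms(1)])
  fix k
  have "norm (a * p ^ k) \<le> norm a * 1"
    unfolding norm_mult norm_power using assms by (intro mult_left_mono power_le_one) auto
  then show "a * p ^ k \<noteq> 1"
    using assms(2) by auto
qed

text \<open>Each factor has norm at most \<open>1 + norm (a * p ^ k)\<close>, hence at most the
  exponential of \<open>norm (a * p ^ k)\<close>, and these exponents add up to at most the full
  geometric series. The bound is independent of \<open>n\<close>, which makes it usable as a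
  majorant.\<close>

lemma norm_qpoch_le:
  assumes "norm p < 1"
  shows "norm (qpoch a p n) \<le> exp (norm a / (1 - norm p))"
proof -
  have "norm (qpoch a p n) \<le> (\<Prod>k<n. 1 + norm (a * p ^ k))"
    unfolding qpoch_def prod_norm[symmetric]
    by (intro prod_mono) (use norm_triangle_ineq4 [of "1 :: complex"] in auto)
  also have "\<dots> \<le> exp (\<Sum>k<n. norm (a * p ^ k))"
    by (rule prod_le_exp_sum) simp
  also have "(\<Sum>k<n. norm (a * p ^ k)) \<le> (\<Sum>k. norm (a * p ^ k))"
    by (rule sum_le_suminf[OF summable_norm_geometric[OF assms]]) auto
  also have "\<dots> = norm a / (1 - norm p)"
    using assms by (simp add: norm_mult norm_power suminf_mult suminf_geometric)
  finally show ?thesis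
    by simp
qed

lemma norm_qpoch_inf_le:
  assumes "norm p < 1"
  shows "norm (qpoch_inf a p) \<le> exp (norm a / (1 - norm p))"
  by (rule LIMSEQ_le_const2[OF tendsto_norm[OF qpoch_LIMSEQ[OF assms]]])
     (use norm_qpoch_le[OF assms] in auto)

text \<open>The partial products are polynomials in \<open>a\<close>. On a unit disc around
  \<open>x\<close> their factors differ from 1 by at most a geometric term, so the products converge
  uniformly there.\<close>

lemma qpoch_inf_holomorphic:
  assumes "norm p < 1"
  shows "(\<lambda>a. qpoch_inf a p) holomorphic_on UNIV"
proof (rule holomorphic_uniform_sequence)
  show "(\<lambda>a. qpoch a p n) holomorphic_on UNIV" for n
    unfolding qpoch_def by (intro holomorphic_intros)
  fix x :: complex
  have "uniform_limit (cball x 1) (\<lambda>N a. \<Sum>n<N. norm (1 - a * p ^ n - 1))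
          (\<lambda>a. \<Sum>n. norm (1 - a * p ^ n - 1)) sequentially"
  proof (rule Weierstrass_m_test)
    show "summable (\<lambda>n. (norm x + 1) * norm p ^ n)"
      using assms by (intro summable_mult summable_geometric) auto
    fix n and a :: complex
    assume "a \<in> cball x 1"
    then have "norm a \<le> norm x + 1"
      using norm_triangle_sub[of a x] by (simp add: dist_norm norm_minus_commute)
    then show "norm (norm (1 - a * p ^ n - 1)) \<le> (norm x + 1) * norm p ^ n"
      by (simp add: norm_mult norm_power mult_right_mono)
  qed
  then have "uniformly_convergent_on (cball x 1) (\<lambda>N a. \<Sum>n<N. norm (1 - a * p ^ n - 1))"
    by (rule uniformly_convergentI)
  then have "uniformly_convergent_on (cball x 1) (\<lambda>N a. qpoch a p N)"
    unfolding qpoch_def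
    by (intro uniformly_convergent_on_prod') (auto intro!: continuous_intros)
  then obtain l where l: "uniform_limit (cball x 1) (\<lambda>N a. qpoch a p N) l sequentially"
    by (auto simp: uniformly_convergent_on_def)
  \<comment> \<open>Uniform convergence gives only some limit function \<open>l\<close>; pointwise
    convergence identifies it.\<close>
  moreover have "l a = qpoch_inf a p" if "a \<in> cball x 1" for a
    using tendsto_uniform_limitI[OF l that] qpoch_LIMSEQ[OF assms] LIMSEQ_unique by blast
  ultimately have "uniform_limit (cball x 1) (\<lambda>N a. qpoch a p N) (\<lambda>a. qpoch_inf a p) sequentially"
    using uniform_limit_cong' by (metis (no_types, lifting))
  then show "\<exists>d>0. cball x d \<subseteq> UNIV \<and>
      uniform_limit (cball x d) (\<lambda>n a. qpoch a p n) (\<lambda>a. qpoch_inf a p) sequentially"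
    by (intro exI[of _ 1]) auto
qed auto

subsection \<open>The Jacobi triple product\<close>

lemma summable_power_square:
  fixes r R :: real
  assumes "0 \<le> r" "r < 1" "0 \<le> R"
  shows "summable (\<lambda>n. r ^ (n ^ 2) * R ^ n)"
proof (rule summable_comparison_test_ev)
  have "(\<lambda>n. r ^ n * R) \<longlonglongrightarrow> 0 * R"
    using assms by (intro tendsto_mult LIMSEQ_realpow_zero tendsto_const)
  then have "eventually (\<lambda>n. r ^ n * R < 1 / 2) sequentially"
    by (intro order_tendstoD(2)) auto
  then show "eventually (\<lambda>n. norm (r ^ (n ^ 2) * R ^ n) \<le> (1 / 2) ^ n) sequentially"
  proof eventually_elim
    case (elim n)
    \<comment> \<open>The quadratic exponent turns the term into an \<open>n\<close>-th power whose
      base tends to 0.\<close>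
    have "r ^ (n ^ 2) * R ^ n = (r ^ n * R) ^ n"
      by (simp add: power_mult_distrib power_mult power2_eq_square)
    also have "\<dots> \<le> (1 / 2) ^ n"
      using elim assms by (intro power_mono) auto
    finally show ?case
      using assms by simp
  qed
  show "summable (\<lambda>n. (1 / 2 :: real) ^ n)"
    by (rule summable_geometric) simp
qed

lemma summable_on_intI:
  fixes f :: "int \<Rightarrow> 'a :: banach"
  assumes "summable (\<lambda>n. norm (f (int n)))" and "summable (\<lambda>n. norm (f (- int n)))"
  shows "f summable_on UNIV"
proof -
  \<comment> \<open>The negative half is shifted by one so that the index 0 is counted only
    once.\<close>
  have "summable (\<lambda>n. norm (f (- int (Suc n))))"
    using assms(2) summable_Suc_iff[of "\<lambda>n. norm (f (- int n))"] by simp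
  then have "(f \<circ> int) summable_on UNIV" "(f \<circ> (\<lambda>n. - int (Suc n))) summable_on UNIV"
    using assms(1) by (auto intro!: norm_summable_imp_summable_on simp: o_def)
  then have "f summable_on range int" "f summable_on range (\<lambda>n. - int (Suc n))"
    by (simp_all add: summable_on_reindex inj_on_def)
  then have "f summable_on (range int \<union> range (\<lambda>n. - int (Suc n)))"
    by (rule summable_on_Un_disjoint) auto
  also have "range int \<union> range (\<lambda>n. - int (Suc n)) = UNIV"
  proof -
    have "k \<in> range int \<union> range (\<lambda>n. - int (Suc n))" for k
      by (cases k) (simp_all del: of_nat_Suc)
    then show ?thesis
      by blast
  qed
  finally show ?thesis .
qed

lemma norm_theta_term:
  fixes q z :: complex
  shows "norm (q powi (k ^ 2) * z powi k) = norm q ^ nat (k ^ 2) * norm z powi k"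
  by (simp add: norm_mult norm_power power_int_def norm_inverse)

lemma theta_abs_summable:
  fixes q z :: complex
  assumes "norm q < 1" "z \<noteq> 0"
  shows "(\<lambda>k. norm (q powi (k ^ 2) * z powi k)) summable_on UNIV"
proof (rule summable_on_intI)
  have nat_sq: "nat ((int n)\<^sup>2) = n ^ 2" for n
    by (metis nat_int of_nat_power)
  have "norm z powi (- int n) = inverse (norm z) ^ n" for n
    by (simp add: power_int_minus power_inverse)
  then show "summable (\<lambda>n. norm (norm (q powi ((- int n)\<^sup>2) * z powi (- int n))))"
    using summable_power_square[of "norm q" "inverse (norm z)"] assms
    unfolding norm_theta_term unfolding power2_minus nat_sq by simp
  show "summable (\<lambda>n. norm (norm (q powi ((int n)\<^sup>2) * z powi (int n))))"
    using summable_power_square[of "norm q" "norm z"] assms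
    unfolding norm_theta_term nat_sq by simp
qed

section \<open>Finite form of the triple product\<close>

definition inv_qfact :: "complex \<Rightarrow> int \<Rightarrow> complex" where
  "inv_qfact p m = (if m < 0 then 0 else 1 / qpoch p p (nat m))"

lemma qpoch_self_nonzero:
  assumes "norm p < 1"
  shows "qpoch p p n \<noteq> 0"
proof -
  have "p * p ^ k \<noteq> 1" for k
  proof
    assume "p * p ^ k = 1"
    then have "norm p ^ Suc k = 1"
      by (metis norm_one norm_power power_Suc)
    moreover have "norm p ^ Suc k < 1"
      using assms power_less_one_iff[of "norm p" "Suc k"] by simp
    ultimately show False
      by simp
  qed
  then show ?thesis
    by (auto simp: qpoch_def)
qed

text \<open>For negative \<open>m\<close> the extension by zero fits the recurrence: at
  \<open>m = -1\<close> the factor \<open>1 - p powi 0\<close> vanishes, and below that both sides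
  are 0. This spares all boundary cases in the finite triple product.\<close>

lemma inv_qfact_rec:
  assumes "norm p < 1"
  shows "inv_qfact p m = (1 - p powi (m + 1)) * inv_qfact p (m + 1)"
proof (cases "m \<ge> 0")
  case True
  then obtain n where n: "m = int n"
    using nonneg_int_cases by blast
  have "inv_qfact p (m + 1) = 1 / qpoch p p (Suc n)" "p powi (m + 1) = p * p ^ n"
    by (simp_all add: n inv_qfact_def nat_add_distrib power_int_add_1' flip: of_nat_Suc)
  moreover have "qpoch p p (Suc n) \<noteq> 0"
    by (rule qpoch_self_nonzero[OF assms])
  ultimately show ?thesis
    by (auto simp: n inv_qfact_def qpoch_Suc field_simps)
next
  case False
  then show ?thesis
    by (cases "m = -1") (auto simp: inv_qfact_def)
qed

lemma inv_qfact_LIMSEQ: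
  assumes "norm p < 1"
  shows "(\<lambda>n. inv_qfact p (int n + k)) \<longlonglongrightarrow> 1 / qpoch_inf p p"
proof -
  have lim: "(\<lambda>n. 1 / qpoch p p n) \<longlonglongrightarrow> 1 / qpoch_inf p p"
    using assms by (intro tendsto_intros qpoch_LIMSEQ qpoch_inf_nonzero_small)
  have "filterlim (\<lambda>n. nat (int n + k)) sequentially sequentially"
    unfolding filterlim_at_top
  proof
    fix Z :: nat
    show "eventually (\<lambda>n. Z \<le> nat (int n + k)) sequentially"
      using eventually_ge_at_top[of "Z + nat \<bar>k\<bar>"] by eventually_elim auto
  qed
  from filterlim_compose[OF lim this]
  have "(\<lambda>n. 1 / qpoch p p (nat (int n + k))) \<longlonglongrightarrow> 1 / qpoch_inf p p" .
  moreover have "eventually (\<lambda>n. 1 / qpoch p p (nat (int n + k)) = inv_qfact p (int n + k)) sequentially"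
    using eventually_ge_at_top[of "nat \<bar>k\<bar>"] by eventually_elim (auto simp: inv_qfact_def)
  ultimately show ?thesis
    by (rule Lim_transform_eventually)
qed

lemma inv_qfact_bounded:
  assumes "norm p < 1"
  obtains B where "\<And>m. norm (inv_qfact p m) \<le> B"
proof -
  have "(\<lambda>n. inv_qfact p (int n + 0)) \<longlonglongrightarrow> 1 / qpoch_inf p p"
    by (rule inv_qfact_LIMSEQ[OF assms])
  then have "Bseq (\<lambda>n. inv_qfact p (int n + 0))"
    by (intro convergent_imp_Bseq convergentI)
  then obtain B where B: "B > 0" "\<And>n. norm (inv_qfact p (int n)) \<le> B"
    by (auto elim: BseqE)
  have "norm (inv_qfact p m) \<le> B" for m
    using B by (cases m) (auto simp: inv_qfact_def)
  then show ?thesis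
    by (rule that)
qed

text \<open>
  Coefficients of the finite triple product: up to the factor \<open>(-1)^k q^(k^2)\<close>, the
  \<open>q^2\<close>-binomial coefficient of \<open>2 * n\<close> over \<open>n + k\<close>.
\<close>

definition triple_coeff :: "complex \<Rightarrow> nat \<Rightarrow> int \<Rightarrow> complex" where
  "triple_coeff q n k = (- 1) powi k * q powi (k ^ 2) * qpoch (q ^ 2) (q ^ 2) (2 * n) *
     inv_qfact (q ^ 2) (int n + k) * inv_qfact (q ^ 2) (int n - k)"

text \<open>This is multiplication by
  \<open>(1 - z * q ^ (2 * n + 1)) * (1 - q ^ (2 * n + 1) / z)\<close>, which equals
  \<open>1 + q ^ (4 * n + 2) - q ^ (2 * n + 1) * (z + 1 / z)\<close>, read off at the coefficient of
  \<open>z powi k\<close>. Writing all reciprocal factorials as multiples of \<open>a\<close> and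
  \<open>b\<close>, those with the largest indices, reduces it to an identity in \<open>p\<close>,
  \<open>N\<close> and \<open>X\<close>.\<close>

lemma triple_coeff_rec:
  assumes "q \<noteq> 0" "norm q < 1"
  shows "triple_coeff q (Suc n) k =
    (1 + q ^ (4 * n + 2)) * triple_coeff q n k
      - q ^ (2 * n + 1) * (triple_coeff q n (k - 1) + triple_coeff q n (k + 1))"
proof -
  define p N X where "p = q ^ 2" and "N = p ^ n" and "X = p powi k"
  define a b where "a = inv_qfact p (int n + k + 1)" and "b = inv_qfact p (int n - k + 1)"
  define s where "s = (- 1) powi k * q powi (k ^ 2)"
  have p: "norm p < 1" "p \<noteq> 0"
    using assms by (auto simp: p_def norm_power power_less_one_iff)
  have X: "X \<noteq> 0"
    using p by (simp add: X_def)
  have pw: "p powi (int n + k) = N * X" "p powi (int n - k) = N / X"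
    "p powi (int n + k + 1) = N * X * p" "p powi (int n - k + 1) = N / X * p"
    using p by (simp_all add: power_int_add power_int_diff N_def X_def)
  have u: "inv_qfact p (int n + k) = (1 - N * X * p) * a"
    "inv_qfact p (int n - k) = (1 - N / X * p) * b"
    "inv_qfact p (int n + k - 1) = (1 - N * X) * ((1 - N * X * p) * a)"
    "inv_qfact p (int n - k - 1) = (1 - N / X) * ((1 - N / X * p) * b)"
    using inv_qfact_rec[OF p(1), of "int n + k"] inv_qfact_rec[OF p(1), of "int n - k"]
      inv_qfact_rec[OF p(1), of "int n + k - 1"] inv_qfact_rec[OF p(1), of "int n - k - 1"]
    by (simp_all only: pw a_def b_def diff_add_cancel)
  have q2: "q powi (2 * k) = X"
    by (simp add: X_def p_def power_int_mult)
  have sq: "(k - 1)\<^sup>2 = k ^ 2 - 2 * k + 1" "(k + 1)\<^sup>2 = k ^ 2 + 2 * k + 1"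
    by (simp_all add: power2_eq_square algebra_simps)
  have s: "(- 1) powi (k - 1) * q powi ((k - 1)\<^sup>2) = - s * q / X"
    "(- 1) powi (k + 1) * q powi ((k + 1)\<^sup>2) = - s * q * X"
    unfolding sq using assms
    by (simp_all add: s_def power_int_add power_int_diff q2)
  have Q: "qpoch p p (2 * Suc n) = qpoch p p (2 * n) * (1 - p * N ^ 2) * (1 - p ^ 2 * N ^ 2)"
    by (simp add: qpoch_Suc N_def power_mult_distrib power2_eq_square power_add mult_2)
  have pows: "q ^ (4 * n + 2) = p * N ^ 2" "q ^ (2 * n + 1) = q * N"
    by (simp_all add: p_def N_def power_add mult.commute flip: power_mult)
       (simp add: power2_eq_square)
  have idx: "int (Suc n) + k = int n + k + 1" "int (Suc n) - k = int n - k + 1"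
    "int n + (k - 1) = int n + k - 1" "int n - (k - 1) = int n - k + 1"
    "int n + (k + 1) = int n + k + 1" "int n - (k + 1) = int n - k - 1"
    by simp_all
  have c: "triple_coeff q (Suc n) k = s * qpoch p p (2 * Suc n) * a * b"
    "triple_coeff q n k = s * qpoch p p (2 * n) * ((1 - N * X * p) * a) * ((1 - N / X * p) * b)"
    "triple_coeff q n (k - 1) =
       (- s * q / X) * qpoch p p (2 * n) * ((1 - N * X) * ((1 - N * X * p) * a)) * b"
    "triple_coeff q n (k + 1) =
       (- s * q * X) * qpoch p p (2 * n) * a * ((1 - N / X) * ((1 - N / X * p) * b))"
    unfolding triple_coeff_def p_def[symmetric] s s_def[symmetric]
    using idx by (simp_all only: u a_def[symmetric] b_def[symmetric])
  \<comment> \<open>What remains once the common factors \<open>s\<close>, \<open>a\<close>,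
    \<open>b\<close> and \<open>qpoch p p (2 * n)\<close> are taken out.\<close>
  have "(1 - p * N ^ 2) * (1 - p ^ 2 * N ^ 2) =
      (1 + p * N ^ 2) * (1 - N * X * p) * (1 - N / X * p)
        + N * p * ((1 - N * X) * (1 - N * X * p) / X + X * (1 - N / X) * (1 - N / X * p))"
  proof -
    \<comment> \<open>A name for the inverse makes the identity polynomial, modulo
      \<open>X * Y = 1\<close>.\<close>
    define Y where "Y = inverse X"
    have "X * Y = 1"
      using X by (simp add: Y_def)
    then have "(1 - p * N ^ 2) * (1 - p ^ 2 * N ^ 2) =
      (1 + p * N ^ 2) * (1 - N * X * p) * (1 - N * Y * p)
        + N * p * ((1 - N * X) * (1 - N * X * p) * Y + X * (1 - N * Y) * (1 - N * Y * p))"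
      by algebra
    then show ?thesis
      by (simp add: Y_def divide_inverse)
  qed
  moreover have "p = q * q"
    by (simp add: p_def power2_eq_square)
  ultimately show ?thesis
    unfolding c Q pows divide_inverse by algebra
qed

text \<open>By induction: the two new factors of the product act on the coefficients as in
  \<open>triple_coeff_rec\<close>, and multiplication by \<open>z\<close> or \<open>1 / z\<close> is
  a shift of the summation index.\<close>

lemma finite_triple_product:
  assumes "q \<noteq> 0" "norm q < 1" "z \<noteq> 0"
  shows "((\<lambda>k. triple_coeff q n k * z powi k) has_sum
           (qpoch (z * q) (q ^ 2) n * qpoch (q / z) (q ^ 2) n)) UNIV"
proof (induction n)
  case 0
  \<comment> \<open>For \<open>n = 0\<close> and nonzero \<open>k\<close>, one of \<open>k\<close>
    and \<open>- k\<close> is negative, so one \<open>inv_qfact\<close> vanishes.\<close>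
  have "triple_coeff q 0 k * z powi k = (if k = 0 then 1 else 0)" for k
    by (auto simp: triple_coeff_def inv_qfact_def)
  then show ?case
    by (simp only:) (intro has_sum_finite_neutralI[of "{0}"], auto)
next
  case (Suc n)
  let ?P = "qpoch (z * q) (q ^ 2) n * qpoch (q / z) (q ^ 2) n"
  let ?c = "\<lambda>k. triple_coeff q n k * z powi k"
  have up: "((\<lambda>k. triple_coeff q n (k - 1) * z powi k) has_sum (?P * z)) UNIV"
  proof -
    have "((\<lambda>k. ?c k * z) has_sum (?P * z)) UNIV"
      by (rule has_sum_cmult_left[OF Suc])
    also have "?this \<longleftrightarrow> ?thesis"
      by (rule has_sum_reindex_bij_witness[of _ "\<lambda>k. k - 1" "\<lambda>k. k + 1"])
         (use assms in \<open>auto simp: power_int_add\<close>)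
    finally show ?thesis .
  qed
  have down: "((\<lambda>k. triple_coeff q n (k + 1) * z powi k) has_sum (?P / z)) UNIV"
  proof -
    have "((\<lambda>k. ?c k * inverse z) has_sum (?P * inverse z)) UNIV"
      by (rule has_sum_cmult_left[OF Suc])
    also have "?this \<longleftrightarrow> ((\<lambda>k. triple_coeff q n (k + 1) * z powi k) has_sum (?P * inverse z)) UNIV"
      by (rule has_sum_reindex_bij_witness[of _ "\<lambda>k. k + 1" "\<lambda>k. k - 1"])
         (use assms in \<open>auto simp: power_int_diff field_simps\<close>)
    finally show ?thesis
      by (simp add: field_simps)
  qed
  have "((\<lambda>k. (1 + q ^ (4 * n + 2)) * ?c k + (- (q ^ (2 * n + 1))) *
          (triple_coeff q n (k - 1) * z powi k + triple_coeff q n (k + 1) * z powi k))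
       has_sum ((1 + q ^ (4 * n + 2)) * ?P + (- (q ^ (2 * n + 1))) * (?P * z + ?P / z))) UNIV"
    by (intro has_sum_cmult_right has_sum_add Suc up down)
  also have "(\<lambda>k. (1 + q ^ (4 * n + 2)) * ?c k + (- (q ^ (2 * n + 1))) *
          (triple_coeff q n (k - 1) * z powi k + triple_coeff q n (k + 1) * z powi k)) =
       (\<lambda>k. triple_coeff q (Suc n) k * z powi k)"
    by (simp add: triple_coeff_rec[OF assms(1,2)] algebra_simps)
  also have "(1 + q ^ (4 * n + 2)) * ?P + (- (q ^ (2 * n + 1))) * (?P * z + ?P / z) =
      ?P * ((1 - z * q * (q ^ 2) ^ n) * (1 - q / z * (q ^ 2) ^ n))"
  proof -
    have "(q ^ 2) ^ n = q ^ (2 * n)" "q ^ (4 * n + 2) = (q * q ^ (2 * n)) ^ 2"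
      by (simp_all add: power_mult_distrib algebra_simps flip: power_mult)
         (simp add: power2_eq_square)
    then show ?thesis
      using assms by (simp add: field_simps power2_eq_square)
  qed
  finally show ?case
    by (simp add: qpoch_Suc mult_ac)
qed

text \<open>Let \<open>n\<close> tend to infinity in \<open>finite_triple_product\<close>. Tannery's
  theorem permits the limit under the sum, since the terms are dominated by a constant multiple of
  the absolutely convergent theta series.\<close>

theorem Jacobi_triple_product:
  assumes "q \<noteq> 0" "norm q < 1" "z \<noteq> 0"
  shows "((\<lambda>k. (- 1) powi k * q powi (k ^ 2) * z powi k) has_sum
           qpochs_inf [z * q, q / z, q ^ 2] (q ^ 2)) UNIV"
proof -
  define p where "p = q ^ 2"
  have p: "norm p < 1"
    using assms by (auto simp: p_def norm_power power_less_one_iff)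
  have p_inf: "qpoch_inf p p \<noteq> 0"
    by (rule qpoch_inf_nonzero_small[OF p p])
  obtain B where B: "\<And>m. norm (inv_qfact p m) \<le> B"
    using inv_qfact_bounded[OF p] by blast
  define E where "E = exp (norm p / (1 - norm p))"
  define t where "t k = (- 1) powi k * q powi (k ^ 2) * z powi k" for k :: int
  have t_sum: "(\<lambda>k. norm (t k)) summable_on UNIV"
    using theta_abs_summable[OF assms(2,3)] by (simp add: t_def norm_mult norm_power_int)
  \<comment> \<open>Tannery's theorem concerns series over the natural numbers, so the integers are
    enumerated by \<open>int_decode\<close>.\<close>
  have bij: "bij int_decode"
    by (rule bij_int_decode)
  have t_sum': "summable (\<lambda>j. norm (t (int_decode j)))"
    using t_sum summable_on_reindex_bij_betw[OF bij, of "\<lambda>k. norm (t k)"]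
    by (simp add: summable_on_UNIV_nonneg_real_iff)
  have lim: "(\<lambda>n. \<Sum>j. triple_coeff q n (int_decode j) * z powi int_decode j)
       \<longlonglongrightarrow> (\<Sum>j. t (int_decode j) / qpoch_inf p p)"
  proof (rule conjunct2[OF conjunct2[OF tannerys_theorem]])
    fix j
    define k where "k = int_decode j"
    have "(\<lambda>n. qpoch p p (2 * n)) \<longlonglongrightarrow> qpoch_inf p p"
      by (rule filterlim_compose[OF qpoch_LIMSEQ[OF p]]) (simp add: filterlim_subseq strict_mono_def)
    \<comment> \<open>One factor tends to \<open>qpoch_inf p p\<close> and two tend to its
      reciprocal, so a single reciprocal survives; it supplies the third product of the final
      formula.\<close>
    then have "(\<lambda>n. t k * (qpoch p p (2 * n) * inv_qfact p (int n + k) * inv_qfact p (int n + (- k))))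
       \<longlonglongrightarrow> t k * (qpoch_inf p p * (1 / qpoch_inf p p) * (1 / qpoch_inf p p))"
      by (intro tendsto_intros inv_qfact_LIMSEQ p)
    then show "(\<lambda>n. triple_coeff q n (int_decode j) * z powi int_decode j)
       \<longlonglongrightarrow> t (int_decode j) / qpoch_inf p p"
      using p_inf by (simp add: triple_coeff_def t_def k_def p_def mult_ac)
  next
    have "norm (triple_coeff q n k * z powi k) \<le> norm (t k) * (E * B * B)" for n k
    proof -
      have "norm (triple_coeff q n k * z powi k) = norm (t k) *
          (norm (qpoch p p (2 * n)) * norm (inv_qfact p (int n + k)) * norm (inv_qfact p (int n - k)))"
        by (simp add: triple_coeff_def t_def p_def norm_mult mult_ac)
      also have "\<dots> \<le> norm (t k) * (E * B * B)"
        unfolding E_def using order_trans[OF norm_ge_zero B]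
        by (intro mult_left_mono mult_mono norm_qpoch_le B p mult_nonneg_nonneg) auto
      finally show ?thesis .
    qed
    then show "eventually (\<lambda>(j, n). norm (triple_coeff q n (int_decode j) * z powi int_decode j)
        \<le> norm (t (int_decode j)) * (E * B * B)) (at_top \<times>\<^sub>F sequentially)"
      by (intro always_eventually) auto
    show "summable (\<lambda>j. norm (t (int_decode j)) * (E * B * B))"
      by (intro summable_mult2 t_sum')
  qed auto
  have "((\<lambda>j. triple_coeff q n (int_decode j) * z powi int_decode j) has_sum
      (qpoch (z * q) p n * qpoch (q / z) p n)) UNIV" for n
    using finite_triple_product[OF assms, of n]
      has_sum_reindex_bij_betw[OF bij, of "\<lambda>k. triple_coeff q n k * z powi k"]
    by (simp add: p_def)
  then have "(\<Sum>j. triple_coeff q n (int_decode j) * z powi int_decode j) =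
      qpoch (z * q) p n * qpoch (q / z) p n" for n
    using has_sum_imp_sums sums_unique by (metis (no_types, lifting))
  moreover have "(\<lambda>n. qpoch (z * q) p n * qpoch (q / z) p n) \<longlonglongrightarrow>
      qpoch_inf (z * q) p * qpoch_inf (q / z) p"
    by (intro tendsto_mult qpoch_LIMSEQ p)
  ultimately have "(\<Sum>j. t (int_decode j) / qpoch_inf p p) = qpoch_inf (z * q) p * qpoch_inf (q / z) p"
    using lim LIMSEQ_unique by auto
  moreover have t_sums: "summable (\<lambda>j. t (int_decode j))"
    by (rule summable_norm_cancel[OF t_sum'])
  ultimately have "(\<Sum>j. t (int_decode j)) = qpochs_inf [z * q, q / z, q ^ 2] (q ^ 2)"
    using p_inf by (simp add: suminf_divide qpochs_inf_def p_def field_simps)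
  then have "((\<lambda>j. t (int_decode j)) has_sum qpochs_inf [z * q, q / z, q ^ 2] (q ^ 2)) UNIV"
    using norm_summable_imp_has_sum[OF t_sum' summable_sums[OF t_sums]] by simp
  then have "(t has_sum qpochs_inf [z * q, q / z, q ^ 2] (q ^ 2)) UNIV"
    using has_sum_reindex_bij_betw[OF bij, of t] by simp
  then show ?thesis
    by (simp add: t_def[abs_def])
qed

subsection \<open>The series cleared of its poles\<close>

text \<open>This is the term of \<open>F4\<close> times \<theta>. The finite denominator has been
  cancelled against the infinite products, leaving their tails, so the expression is meaningful at
  the poles too.\<close>

definition F4_cleared :: "complex \<Rightarrow> complex \<Rightarrow> nat \<Rightarrow> complex" where
  "F4_cleared q z n = (- 1) ^ n * qpoch q (- q) (2 * n) * q ^ (n + 1) *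
     qpochs_inf [z * q * (q ^ 2) ^ (n + 1), q / z * (q ^ 2) ^ (n + 1), q ^ 2] (q ^ 2)"

text \<open>
  \<open>\<theta>\<close> times the certificate found by solving the telescoping relation below with the ansatz
  \<open>c(z) (-1)^n (q;-q)_{2n} q^n / ((zq;q^2)_{n+1} (q/z;q^2)_n)\<close>; this gives \<open>c(z) = zq - 1\<close>.
\<close>

definition F4_certificate :: "complex \<Rightarrow> complex \<Rightarrow> nat \<Rightarrow> complex" where
  "F4_certificate q z n = - ((1 - z * q) * ((- 1) ^ n * qpoch q (- q) (2 * n) * q ^ n *
     qpochs_inf [z * q * (q ^ 2) ^ (n + 1), q / z * (q ^ 2) ^ n, q ^ 2] (q ^ 2)))"

lemma norm_power2_less_1:
  fixes q :: complex
  assumes "norm q < 1"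
  shows "norm (q ^ 2) < 1"
  using assms by (simp add: norm_power power_less_one_iff)

text \<open>Replacing \<open>z\<close> by \<open>q ^ 2 * z\<close> removes one factor from the first
  tail and adds one to the second. All four terms are therefore a common factor \<open>K\<close>,
  built from the shortest tails \<open>a\<close> and \<open>b\<close>, times explicit polynomials in
  \<open>q\<close>, \<open>z\<close>, \<open>N\<close> and \<open>Y\<close>.\<close>

lemma F4_telescoping:
  assumes "q \<noteq> 0" "norm q < 1" "z \<noteq> 0"
  shows "(1 - z) * F4_cleared q z n + (1 - q ^ 2 * z) * F4_cleared q (q ^ 2 * z) n / q =
           F4_certificate q z (Suc n) - F4_certificate q z n"
proof -
  define p N Y where "p = q ^ 2" and "N = p ^ n" and "Y = inverse z"
  have p: "norm p < 1" "p \<noteq> 0"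
    using assms norm_power2_less_1 by (auto simp: p_def)
  define a b where "a = qpoch_inf (z * q * (p * (p * N))) p"
    and "b = qpoch_inf (q / z * (p * N)) p"
  define K where "K = (- 1) ^ n * qpoch q (- q) (2 * n) * q ^ n * a * b * qpoch_inf p p"
  have a: "qpoch_inf (z * q * (p * N)) p = (1 - z * q * (p * N)) * a"
    using qpoch_inf_rec[OF p(1), of "z * q * (p * N)"] by (simp add: a_def mult_ac)
  have b: "qpoch_inf (q / z * N) p = (1 - q * N * Y) * b"
    using qpoch_inf_rec[OF p(1), of "q / z * N"] by (simp add: b_def Y_def divide_inverse mult_ac)
  \<comment> \<open>The base is \<open>- q\<close>, so the two new factors have opposite signs: the
    exponents \<open>2 * n\<close> and \<open>2 * n + 1\<close> give \<open>1 - q * N\<close> and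
    \<open>1 + p * N\<close>.\<close>
  have A: "qpoch q (- q) (2 * Suc n) = qpoch q (- q) (2 * n) * (1 - q * N) * (1 + p * N)"
    by (simp add: qpoch_Suc N_def p_def power2_eq_square power_mult)
  have "F4_cleared q z n = K * q * (1 - z * q * (p * N))"
    by (simp add: F4_cleared_def qpochs_inf_def K_def a b_def
        flip: p_def N_def)
  moreover have "F4_cleared q (p * z) n = K * q * (1 - q * N * Y)"
  proof -
    have "p * z * q * p ^ (n + 1) = z * q * (p * (p * N))" "q / (p * z) * p ^ (n + 1) = q / z * N"
      using p assms by (simp_all add: N_def)
    then show ?thesis
      unfolding F4_cleared_def p_def[symmetric] qpochs_inf_def list.map
      by (simp only: b a_def[symmetric]) (simp add: K_def)
  qed
  moreover have "F4_certificate q z n = - ((1 - z * q) * K * (1 - z * q * (p * N)) * (1 - q * N * Y))"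
  proof -
    have "z * q * p ^ (n + 1) = z * q * (p * N)"
      by (simp add: N_def)
    then show ?thesis
      unfolding F4_certificate_def p_def[symmetric] qpochs_inf_def list.map N_def[symmetric]
      by (simp only: a b) (simp add: K_def)
  qed
  moreover have "F4_certificate q z (Suc n) = (1 - z * q) * K * q * (1 - q * N) * (1 + p * N)"
    unfolding F4_certificate_def A
    by (simp add: qpochs_inf_def K_def a_def b_def flip: p_def N_def)
  moreover have "(1 - z) * (K * q * (1 - z * q * (p * N))) + (1 - p * z) * (K * (1 - q * N * Y)) =
      (1 - z * q) * K * q * (1 - q * N) * (1 + p * N)
       + (1 - z * q) * K * (1 - z * q * (p * N)) * (1 - q * N * Y)"
  proof -
    have "z * Y = 1" "p = q * q"
      using assms by (simp_all add: Y_def p_def power2_eq_square)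
    then show ?thesis
      by algebra
  qed
  ultimately show ?thesis
    using assms by (simp flip: p_def)
qed

section \<open>Majorants, convergence and holomorphy of the cleared series\<close>

definition F4_bound :: "complex \<Rightarrow> real \<Rightarrow> real" where
  "F4_bound q R = exp (norm q / (1 - norm q)) * (exp (R / (1 - norm (q ^ 2))) *
     (exp (R / (1 - norm (q ^ 2))) * norm (qpoch_inf (q ^ 2) (q ^ 2))))"

lemma norm_qpochs_inf_le:
  assumes "norm q < 1" "norm a \<le> R" "norm b \<le> R"
  shows "norm (qpoch q (- q) m * qpochs_inf [a, b, q ^ 2] (q ^ 2)) \<le> F4_bound q R"
proof -
  have p: "norm (q ^ 2) < 1"
    by (rule norm_power2_less_1[OF assms(1)])
  have bound: "norm (qpoch_inf c (q ^ 2)) \<le> exp (R / (1 - norm (q ^ 2)))" if "norm c \<le> R" for c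
    by (rule order_trans[OF norm_qpoch_inf_le[OF p, of c]])
       (use that p in \<open>simp add: divide_right_mono\<close>)
  have "norm (qpoch q (- q) m) \<le> exp (norm q / (1 - norm q))"
    using norm_qpoch_le[of "- q" q m] assms by simp
  then show ?thesis
    unfolding F4_bound_def qpochs_inf_def norm_mult list.map prod_list.Cons
    using bound assms by (intro mult_mono) auto
qed

lemma norm_mult_power_le:
  fixes q w :: complex
  assumes "norm q < 1"
  shows "norm (w * q * (q ^ 2) ^ n) \<le> norm w"
proof -
  have "norm (w * q * (q ^ 2) ^ n) = norm w * norm q ^ (2 * n + 1)"
    by (simp add: norm_mult norm_power power_mult)
  also have "\<dots> \<le> norm w * 1"
    using assms by (intro mult_left_mono power_le_one) auto
  finally show ?thesis
    by simp
qed

text \<open>The geometric decay comes from the power of \<open>q\<close> in the term; all other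
  factors are bounded. The point \<open>z\<close> enters only through \<open>R\<close>, so the
  estimate is uniform on annuli around 0.\<close>

lemma norm_F4_cleared_le:
  assumes "norm q < 1" "norm z \<le> R" "norm (inverse z) \<le> R"
  shows "norm (F4_cleared q z n) \<le> F4_bound q R * norm q ^ n"
proof -
  have "norm (F4_cleared q z n) = norm (qpoch q (- q) (2 * n) *
      qpochs_inf [z * q * (q ^ 2) ^ (n + 1), inverse z * q * (q ^ 2) ^ (n + 1), q ^ 2] (q ^ 2)) *
      norm q ^ (n + 1)"
    by (simp add: F4_cleared_def norm_mult norm_power divide_inverse mult_ac)
  also have "\<dots> \<le> F4_bound q R * norm q ^ (n + 1)"
    using assms order_trans[OF norm_mult_power_le[OF assms(1)]]
    by (intro mult_right_mono norm_qpochs_inf_le)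
       (auto simp: F4_bound_def simp del: power_Suc)
  also have "\<dots> \<le> F4_bound q R * norm q ^ n"
    using assms by (intro mult_left_mono power_decreasing) (auto simp: F4_bound_def)
  finally show ?thesis .
qed

lemma F4_cleared_summable:
  assumes "norm q < 1"
  shows "summable (F4_cleared q z)"
proof (rule summable_comparison_test')
  show "summable (\<lambda>n. F4_bound q (max (norm z) (norm (inverse z))) * norm q ^ n)"
    using assms by (intro summable_mult summable_geometric) auto
  show "norm (F4_cleared q z n) \<le> F4_bound q (max (norm z) (norm (inverse z))) * norm q ^ n" for n
    using assms by (intro norm_F4_cleared_le) auto
qed

lemma F4_certificate_tendsto_0:
  assumes "norm q < 1"
  shows "F4_certificate q z \<longlonglongrightarrow> 0"
proof (rule Lim_null_comparison)
  define R where "R = max (norm z) (norm (inverse z))"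
  have "norm (F4_certificate q z n) \<le> norm (1 - z * q) * F4_bound q R * norm q ^ n" for n
  proof -
    have "norm (F4_certificate q z n) = norm (1 - z * q) * norm (qpoch q (- q) (2 * n) *
        qpochs_inf [z * q * (q ^ 2) ^ (n + 1), inverse z * q * (q ^ 2) ^ n, q ^ 2] (q ^ 2)) *
        norm q ^ n"
      by (simp add: F4_certificate_def norm_mult norm_power divide_inverse mult_ac)
    also have "\<dots> \<le> norm (1 - z * q) * F4_bound q R * norm q ^ n"
      using assms order_trans[OF norm_mult_power_le[OF assms]]
      by (intro mult_right_mono mult_left_mono norm_qpochs_inf_le)
         (auto simp: R_def F4_bound_def simp del: power_Suc)
    finally show ?thesis .
  qed
  then show "eventually (\<lambda>n. norm (F4_certificate q z n) \<le>
      norm (1 - z * q) * F4_bound q R * norm q ^ n) sequentially"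
    by (intro always_eventually) auto
  show "(\<lambda>n. norm (1 - z * q) * F4_bound q R * norm q ^ n) \<longlonglongrightarrow> 0"
    using assms by (intro tendsto_mult_right_zero LIMSEQ_power_zero) auto
qed

text \<open>Summing the telescoping relation leaves minus the initial certificate, because the
  certificates tend to 0.\<close>

lemma F4_cleared_functional_eq:
  assumes "q \<noteq> 0" "norm q < 1" "z \<noteq> 0"
  shows "(1 - z) * (\<Sum>n. F4_cleared q z n) + (1 - q ^ 2 * z) * (\<Sum>n. F4_cleared q (q ^ 2 * z) n) / q =
           qpochs_inf [z * q, q / z, q ^ 2] (q ^ 2)"
proof -
  have "(\<lambda>n. (1 - z) * F4_cleared q z n + (1 - q ^ 2 * z) * F4_cleared q (q ^ 2 * z) n / q) sums
      ((1 - z) * (\<Sum>n. F4_cleared q z n) + (1 - q ^ 2 * z) * (\<Sum>n. F4_cleared q (q ^ 2 * z) n) / q)"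
    using assms by (intro sums_add sums_mult sums_divide summable_sums F4_cleared_summable)
  moreover have "(\<lambda>n. F4_certificate q z (Suc n) - F4_certificate q z n) sums (0 - F4_certificate q z 0)"
    by (rule telescope_sums[OF F4_certificate_tendsto_0[OF assms(2)]])
  \<comment> \<open>The prefactor \<open>1 - z * q\<close> restores the factor with which the first
    infinite product begins.\<close>
  moreover have "- F4_certificate q z 0 = qpochs_inf [z * q, q / z, q ^ 2] (q ^ 2)"
    using qpoch_inf_rec[OF norm_power2_less_1[OF assms(2)], of "z * q"]
    by (simp add: F4_certificate_def qpochs_inf_def mult_ac)
  ultimately show ?thesis
    unfolding F4_telescoping[OF assms] using sums_unique2 by force
qed

lemma F4_cleared_sum_holomorphic:
  assumes "norm q < 1"
  shows "(\<lambda>z. \<Sum>n. F4_cleared q z n) holomorphic_on - {0}"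
proof (rule holomorphic_uniform_sequence)
  have inf: "(\<lambda>z. qpoch_inf (f z) (q ^ 2)) holomorphic_on - {0}" if "f holomorphic_on - {0}" for f
    using holomorphic_on_compose_gen[OF that qpoch_inf_holomorphic[OF norm_power2_less_1[OF assms]]]
    by (simp add: o_def)
  show "(\<lambda>z. \<Sum>k<n. F4_cleared q z k) holomorphic_on - {0}" for n
    unfolding F4_cleared_def qpochs_inf_def list.map prod_list.Cons prod_list.Nil
    by (intro holomorphic_intros inf) auto
  fix x :: complex
  assume x: "x \<in> - {0}"
  \<comment> \<open>On the disc of radius \<open>norm x / 2\<close> around \<open>x\<close>,
    \<open>norm z\<close> is at most \<open>2 * norm x\<close> and its inverse at most
    \<open>2 / norm x\<close>; the sum \<open>R\<close> dominates both.\<close>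
  define R where "R = 2 * norm x + 2 / norm x"
  have z: "norm z \<le> R" "norm (inverse z) \<le> R" "z \<noteq> 0" if "z \<in> cball x (norm x / 2)" for z
  proof -
    have "norm (x - z) \<le> norm x / 2"
      using that by (simp add: dist_norm)
    then have le: "norm z \<le> 2 * norm x" "norm x / 2 \<le> norm z"
      using norm_triangle_ineq3[of x z] by linarith+
    then show "z \<noteq> 0"
      using x by auto
    have "norm (inverse z) \<le> inverse (norm x / 2)"
      unfolding norm_inverse using le x by (intro le_imp_inverse_le) auto
    then show "norm (inverse z) \<le> R"
      by (simp add: R_def field_simps) (smt (verit) norm_ge_zero mult_nonneg_nonneg)
    show "norm z \<le> R"
      using le by (simp add: R_def) (smt (verit) norm_ge_zero divide_nonneg_nonneg)
  qed
  have "uniform_limit (cball x (norm x / 2)) (\<lambda>N z. \<Sum>n<N. F4_cleared q z n)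
      (\<lambda>z. \<Sum>n. F4_cleared q z n) sequentially"
  proof (rule Weierstrass_m_test)
    show "summable (\<lambda>n. F4_bound q R * norm q ^ n)"
      using assms by (intro summable_mult summable_geometric) auto
  qed (use z assms in \<open>auto intro!: norm_F4_cleared_le\<close>)
  then show "\<exists>d>0. cball x d \<subseteq> - {0} \<and> uniform_limit (cball x d)
      (\<lambda>N z. \<Sum>n<N. F4_cleared q z n) (\<lambda>z. \<Sum>n. F4_cleared q z n) sequentially"
    using x z(3) by (intro exI[of _ "norm x / 2"]) auto
qed auto

subsection \<open>The bilateral sum\<close>

text \<open>The exponent is odd, so the power of \<open>q\<close> has modulus at most
  \<open>norm q\<close> or at least \<open>1 / norm q\<close>. In both cases it stays away from the
  unit circle uniformly in \<open>k\<close>.\<close>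

lemma lerch_denom:
  fixes q :: complex
  assumes "q \<noteq> 0" "norm q < 1"
  shows "1 - norm q \<le> norm (1 + q powi (2 * k - 1))"
proof (cases "k \<ge> 1")
  case True
  define n where "n = nat (2 * k - 2)"
  have n: "2 * k - 1 = int (Suc n)"
    using True by (simp add: n_def)
  have "norm (q powi (2 * k - 1)) = norm q * norm q ^ n"
    unfolding n by (simp add: norm_mult norm_power del: of_nat_Suc)
  also have "\<dots> \<le> norm q * 1"
    using assms by (intro mult_left_mono power_le_one) auto
  finally show ?thesis
    using norm_triangle_ineq2[of 1 "- (q powi (2 * k - 1))"] by simp
next
  case False
  define n where "n = nat (- (2 * k))"
  have n: "2 * k - 1 = - int (Suc n)"
    using False by (simp add: n_def)
  have "1 \<le> inverse (norm q) ^ n"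
    using assms by (intro one_le_power) (simp add: field_simps)
  then have "inverse (norm q) * 1 \<le> inverse (norm q) * inverse (norm q) ^ n"
    by (intro mult_left_mono) auto
  also have "\<dots> = norm (q powi (2 * k - 1))"
    unfolding n by (simp add: power_int_minus norm_inverse norm_mult norm_power power_inverse del: of_nat_Suc)
  finally have *: "inverse (norm q) \<le> norm (q powi (2 * k - 1))"
    by simp
  have "1 - norm q \<le> inverse (norm q) * (1 - norm q)"
    using assms mult_right_mono[of 1 "inverse (norm q)" "1 - norm q"] by (simp add: field_simps)
  also have "\<dots> = inverse (norm q) - 1"
    using assms by (simp add: field_simps)
  also have "\<dots> \<le> norm (q powi (2 * k - 1)) - 1"
    using * by simp
  also have "\<dots> \<le> norm (1 + q powi (2 * k - 1))"
    using norm_triangle_ineq2[of "q powi (2 * k - 1)" "- 1"] by (simp add: add.commute)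
  finally show ?thesis .
qed

lemma lerch_denom_nonzero:
  fixes q :: complex
  assumes "q \<noteq> 0" "norm q < 1"
  shows "1 + q powi (2 * k - 1) \<noteq> 0"
  using lerch_denom[OF assms, of k] assms by auto

lemma lerch_summable:
  assumes "q \<noteq> 0" "norm q < 1" "z \<noteq> 0"
  shows "(\<lambda>k. lerch_coeff q k * z powi k) summable_on UNIV"
proof -
  define c where "c = inverse (1 - norm q)"
  have c: "c \<ge> 0"
    using assms by (simp add: c_def)
  have le: "norm (lerch_coeff q k * z powi k) \<le>
      norm (q powi (k ^ 2) * z powi k * of_real c)" for k
  proof -
    have "norm (lerch_coeff q k) = norm (q powi (k ^ 2)) / norm (1 + q powi (2 * k - 1))"
      by (simp add: lerch_coeff_def norm_mult norm_divide norm_power_int)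
    also have "\<dots> \<le> norm (q powi (k ^ 2)) / (1 - norm q)"
      using lerch_denom[OF assms(1,2), of k] assms lerch_denom_nonzero[OF assms(1,2), of k]
      by (intro divide_left_mono) auto
    also have "\<dots> = norm (q powi (k ^ 2)) * c"
      by (simp add: c_def divide_inverse)
    finally have "norm (lerch_coeff q k) * norm (z powi k) \<le>
        norm (q powi (k ^ 2)) * c * norm (z powi k)"
      by (rule mult_right_mono) simp
    then show ?thesis
      using c by (simp add: norm_mult mult_ac)
  qed
  have "(\<lambda>k. norm (q powi (k ^ 2) * z powi k * of_real c)) summable_on UNIV"
    unfolding norm_mult using theta_abs_summable[OF assms(2,3)]
    by (intro summable_on_cmult_left) (simp add: norm_mult)
  then have "(\<lambda>k. norm (lerch_coeff q k * z powi k)) summable_on UNIV"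
    by (rule Infinite_Sum.abs_summable_on_comparison_test) (rule le)
  then show ?thesis
    by (rule abs_summable_summable)
qed

text \<open>The reflection inverts \<open>X\<close>, and since
  \<open>(1 - k)^2 = k^2 - (2 * k - 1)\<close> it divides the numerator by \<open>X\<close>. The two
  effects cancel, and only the change of sign from the power of \<open>- 1\<close> is left.\<close>

lemma lerch_coeff_reflect:
  assumes "q \<noteq> 0" "norm q < 1"
  shows "lerch_coeff q (1 - k) = - lerch_coeff q k"
proof -
  define X where "X = q powi (2 * k - 1)"
  have X: "X \<noteq> 0" "1 + X \<noteq> 0"
    using assms lerch_denom_nonzero[OF assms] by (auto simp: X_def)
  have "2 * (1 - k) - 1 = - (2 * k - 1)" "(1 - k)\<^sup>2 = k ^ 2 - (2 * k - 1)"
    by (simp_all add: power2_eq_square algebra_simps)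
  then have q: "q powi (2 * (1 - k) - 1) = inverse X" "q powi ((1 - k)\<^sup>2) = q powi (k ^ 2) / X"
    using assms by (simp_all only: X_def power_int_minus power_int_diff simp_thms)
  have sgn: "(- 1 :: complex) powi (1 - k - 1) = - ((- 1) powi (k - 1))"
    by (simp add: power_int_diff power_int_minus flip: power_int_inverse)
  show ?thesis
    unfolding lerch_coeff_def q sgn X_def[symmetric] using X by (simp add: field_simps)
qed

lemma lerch_reflected_has_sum:
  assumes "q \<noteq> 0" "norm q < 1" "z \<noteq> 0"
  shows "((\<lambda>k. lerch_coeff q k * z powi (1 - k)) has_sum
           - (\<Sum>\<^sub>\<infinity>k\<in>UNIV. lerch_coeff q k * z powi k)) UNIV"
proof -
  have "((\<lambda>k. - (lerch_coeff q k * z powi k)) has_sum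
      - (\<Sum>\<^sub>\<infinity>k\<in>UNIV. lerch_coeff q k * z powi k)) UNIV"
    using lerch_summable[OF assms] by (intro has_sum_uminusI has_sum_infsum)
  also have "?this \<longleftrightarrow> ?thesis"
    by (rule has_sum_reindex_bij_witness[of _ "\<lambda>k. 1 - k" "\<lambda>k. 1 - k"])
       (use lerch_coeff_reflect[OF assms(1,2)] in auto)
  finally show ?thesis .
qed

text \<open>The terms with \<open>k \<le> 0\<close> are folded onto those with
  \<open>k \<ge> 1\<close> by the antisymmetry of the coefficients. The bilateral sum is thus
  expressed through one power series \<open>f\<close>, which yields both its holomorphy and the
  one-sided form of the result.\<close>

lemma lerch_half_sums:
  assumes "q \<noteq> 0" "norm q < 1" "z \<noteq> 0"
  defines "f \<equiv> \<lambda>w. \<Sum>n. lerch_coeff q (int n + 1) * w ^ n"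
  shows "((\<lambda>k. lerch_coeff q k * z powi k) has_sum z * f z) {1..}"
    and "((\<lambda>k. lerch_coeff q k * z powi (1 - k)) has_sum f (inverse z)) {1..}"
    and "summable (\<lambda>n. lerch_coeff q (int n + 1) * z ^ n)"
    and "(\<Sum>\<^sub>\<infinity>k\<in>UNIV. lerch_coeff q k * z powi k) = z * f z - f (inverse z)"
proof -
  have bij: "bij_betw (\<lambda>n. int n + 1) UNIV {1..}"
    by (rule bij_betw_byWitness[of _ "\<lambda>k. nat (k - 1)"]) auto
  have has_sum: "((\<lambda>n. lerch_coeff q (int n + 1) * w ^ n) has_sum f w) UNIV"
    if "w \<noteq> 0" for w
  proof -
    have "(\<lambda>k. lerch_coeff q k * w powi k) summable_on {1..}"
      using lerch_summable[OF assms(1,2) that] by (rule summable_on_subset_banach) auto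
    \<comment> \<open>Division by \<open>w\<close> lowers the exponent \<open>n + 1\<close> to
      \<open>n\<close>, as needed for a power series.\<close>
    then have "(\<lambda>n. lerch_coeff q (int n + 1) * w powi (int n + 1) * inverse w) summable_on UNIV"
      using summable_on_reindex_bij_betw[OF bij, of "\<lambda>k. lerch_coeff q k * w powi k"]
      by (intro summable_on_cmult_left) simp
    moreover have "lerch_coeff q (int n + 1) * w powi (int n + 1) * inverse w =
        lerch_coeff q (int n + 1) * w ^ n" for n
      using that by (simp add: power_int_add)
    ultimately have "(\<lambda>n. lerch_coeff q (int n + 1) * w ^ n) summable_on UNIV"
      by simp
    then show ?thesis
      using has_sum_imp_sums sums_unique unfolding f_def by (metis has_sum_infsum)
  qed
  show "summable (\<lambda>n. lerch_coeff q (int n + 1) * z ^ n)"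
    using has_sum[OF assms(3)] by (metis has_sum_imp_sums sums_summable)
  have "((\<lambda>n. lerch_coeff q (int n + 1) * z powi (int n + 1)) has_sum z * f z) UNIV"
    using has_sum_cmult_right[OF has_sum[OF assms(3)], of z] assms(3)
    by (simp add: power_int_add mult_ac)
  then show plus: "((\<lambda>k. lerch_coeff q k * z powi k) has_sum z * f z) {1..}"
    using has_sum_reindex_bij_betw[OF bij, of "\<lambda>k. lerch_coeff q k * z powi k"] by simp
  have "((\<lambda>n. lerch_coeff q (int n + 1) * z powi (1 - (int n + 1))) has_sum f (inverse z)) UNIV"
    using has_sum[of "inverse z"] assms(3) by (simp add: power_int_minus power_inverse)
  then show minus: "((\<lambda>k. lerch_coeff q k * z powi (1 - k)) has_sum f (inverse z)) {1..}"
    using has_sum_reindex_bij_betw[OF bij, of "\<lambda>k. lerch_coeff q k * z powi (1 - k)"] by simp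
  have "((\<lambda>k. - (lerch_coeff q k * z powi (1 - k))) has_sum - f (inverse z)) {1..}"
    by (rule has_sum_uminusI[OF minus])
  also have "?this \<longleftrightarrow> ((\<lambda>k. lerch_coeff q k * z powi k) has_sum - f (inverse z)) {..0}"
    by (rule has_sum_reindex_bij_witness[of _ "\<lambda>k. 1 - k" "\<lambda>k. 1 - k"])
       (use lerch_coeff_reflect[OF assms(1,2)] in auto)
  finally have "((\<lambda>k. lerch_coeff q k * z powi k) has_sum (z * f z + - f (inverse z))) ({1..} \<union> {..0})"
    by (intro has_sum_Un_disjoint plus) auto
  also have "{1..} \<union> {..0} = (UNIV :: int set)"
    by auto
  finally show "(\<Sum>\<^sub>\<infinity>k\<in>UNIV. lerch_coeff q k * z powi k) = z * f z - f (inverse z)"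
    by (simp add: infsumI)
qed

text \<open>The power series \<open>f\<close> converges everywhere, so it is entire, and the
  bilateral sum is \<open>z * f z - f (inverse z)\<close> away from 0.\<close>

lemma lerch_sum_holomorphic:
  assumes "q \<noteq> 0" "norm q < 1"
  shows "(\<lambda>z. \<Sum>\<^sub>\<infinity>k\<in>UNIV. lerch_coeff q k * z powi k) holomorphic_on - {0}"
proof -
  define f where "f w = (\<Sum>n. lerch_coeff q (int n + 1) * w ^ n)" for w
  have "summable (\<lambda>n. lerch_coeff q (int n + 1) * w ^ n)" for w
  proof (cases "w = 0")
    case True
    then show ?thesis
      using summable_finite[of "{0}" "\<lambda>n. lerch_coeff q (int n + 1) * w ^ n"] by simp
  qed (use lerch_half_sums(3)[OF assms] in auto)
  then have "\<exists>D. (f has_field_derivative D) (at w)" for w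
    unfolding f_def using termdiffs_strong_converges_everywhere[of "\<lambda>n. lerch_coeff q (int n + 1)" w]
    by blast
  then have f: "f holomorphic_on UNIV"
    by (auto simp: holomorphic_on_open)
  have "(\<lambda>z. f (inverse z)) holomorphic_on - {0}"
  proof -
    have "inverse holomorphic_on (- {0 :: complex})"
      using holomorphic_on_inverse[OF holomorphic_on_id, of "- {0}"] by (auto simp: id_def)
    from holomorphic_on_compose_gen[OF this f] show ?thesis
      by (simp add: o_def)
  qed
  then have "(\<lambda>z. z * f z - f (inverse z)) holomorphic_on - {0}"
    using holomorphic_on_subset[OF f] by (intro holomorphic_intros) auto
  then show ?thesis
    by (rule holomorphic_transform) (use lerch_half_sums(4)[OF assms] in \<open>auto simp: f_def\<close>)
qed

text \<open>The dilation and the division by \<open>q\<close> multiply the \<open>k\<close>-th term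
  by \<open>q powi (2 * k - 1)\<close>. Adding the original term produces exactly the denominator of
  \<open>lerch_coeff\<close>, and the cancellation leaves the negated theta series.\<close>

lemma lerch_functional_eq:
  assumes "q \<noteq> 0" "norm q < 1" "z \<noteq> 0"
  shows "(\<Sum>\<^sub>\<infinity>k\<in>UNIV. lerch_coeff q k * z powi k)
           + (\<Sum>\<^sub>\<infinity>k\<in>UNIV. lerch_coeff q k * (q ^ 2 * z) powi k) / q =
         - qpochs_inf [z * q, q / z, q ^ 2] (q ^ 2)"
proof -
  have "((\<lambda>k. lerch_coeff q k * z powi k + lerch_coeff q k * (q ^ 2 * z) powi k * inverse q) has_sum
      ((\<Sum>\<^sub>\<infinity>k\<in>UNIV. lerch_coeff q k * z powi k)
        + (\<Sum>\<^sub>\<infinity>k\<in>UNIV. lerch_coeff q k * (q ^ 2 * z) powi k) * inverse q)) UNIV"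
    using assms by (intro has_sum_add has_sum_cmult_left has_sum_infsum lerch_summable) auto
  moreover have "lerch_coeff q k * z powi k + lerch_coeff q k * (q ^ 2 * z) powi k * inverse q =
      - ((- 1) powi k * q powi (k ^ 2) * z powi k)" for k
  proof -
    have "(q ^ 2 * z) powi k * inverse q = q powi (2 * k - 1) * z powi k"
      using assms by (simp add: power_int_mult_distrib power_int_diff power_int_mult divide_inverse)
    then have "lerch_coeff q k * z powi k + lerch_coeff q k * (q ^ 2 * z) powi k * inverse q =
        lerch_coeff q k * (1 + q powi (2 * k - 1)) * z powi k"
      by (simp add: mult.assoc) (simp add: algebra_simps)
    also have "lerch_coeff q k * (1 + q powi (2 * k - 1)) = (- 1) powi (k - 1) * q powi (k ^ 2)"
      using lerch_denom_nonzero[OF assms(1,2), of k] by (simp add: lerch_coeff_def)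
    finally show ?thesis
      by (simp add: power_int_diff)
  qed
  ultimately have "((\<lambda>k. - ((- 1) powi k * q powi (k ^ 2) * z powi k)) has_sum
      ((\<Sum>\<^sub>\<infinity>k\<in>UNIV. lerch_coeff q k * z powi k)
        + (\<Sum>\<^sub>\<infinity>k\<in>UNIV. lerch_coeff q k * (q ^ 2 * z) powi k) * inverse q)) UNIV"
    by simp
  moreover have "((\<lambda>k. - ((- 1) powi k * q powi (k ^ 2) * z powi k)) has_sum
      - qpochs_inf [z * q, q / z, q ^ 2] (q ^ 2)) UNIV"
    by (rule has_sum_uminusI[OF Jacobi_triple_product[OF assms]])
  ultimately show ?thesis
    unfolding divide_inverse by (rule has_sum_unique)
qed

subsection \<open>Comparison of the two sides\<close>

lemma scaling_to_annulus:
  fixes r x :: real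
  assumes "0 < r" "r < 1" "0 < x"
  obtains m :: int where "r \<le> r powi m * x" "r powi m * x \<le> 1"
proof -
  \<comment> \<open>The quotient is the logarithm of \<open>x\<close> to base \<open>r\<close>; its
    integer part is removed by the power \<open>- n\<close>. Since \<open>ln r\<close> is negative,
    clearing the denominator reverses the inequalities.\<close>
  define n where "n = \<lfloor>ln x / ln r\<rfloor>"
  have r: "ln r < 0"
    using assms by simp
  have "of_int n \<le> ln x / ln r" "ln x / ln r \<le> of_int n + 1"
    unfolding n_def by linarith+
  then have "ln x \<le> of_int n * ln r" "(of_int n + 1) * ln r \<le> ln x"
    using r by (simp_all add: field_simps)
  moreover have "r powi (- n) * x = exp (ln x - of_int n * ln r)"
  proof -
    have "r powi n = exp (of_int n * ln r)"
      using assms by (subst powr_real_of_int'[symmetric]) (auto simp: powr_def)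
    then show ?thesis
      using assms by (simp add: exp_diff power_int_minus field_simps)
  qed
  moreover have "exp (ln r) = r"
    using assms by simp
  ultimately have "r \<le> r powi (- n) * x" "r powi (- n) * x \<le> 1"
    using exp_le_cancel_iff[of "ln r" "ln x - of_int n * ln r"] by (simp_all add: algebra_simps)
  then show ?thesis
    by (rule that)
qed

text \<open>
  In the coordinate \<open>w = ln z\<close>, the function \<open>D (exp w) * exp (- w / 2)\<close> is periodic up to sign
  with respect to a lattice, hence constant; as it changes sign under \<open>w \<mapsto> w + 2 * pi * \<i>\<close>, it vanishes.
\<close>

lemma quasiperiodic_eq_0:
  fixes D :: "complex \<Rightarrow> complex"
  assumes "q \<noteq> 0" "norm q < 1" and hol: "D holomorphic_on - {0}"
    and D: "\<And>z. z \<noteq> 0 \<Longrightarrow> D (q ^ 2 * z) = - q * D z" and "z \<noteq> 0"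
  shows "D z = 0"
proof -
  define p where "p = q ^ 2"
  have p: "p \<noteq> 0" "norm p < 1"
    using assms norm_power2_less_1 by (auto simp: p_def)
  define h where "h z = norm (D z) / sqrt (norm z)" for z
  \<comment> \<open>The factor \<open>norm q\<close> from the functional equation cancels against
    \<open>sqrt (norm p) = norm q\<close>.\<close>
  have h: "h (p * z) = h z" if "z \<noteq> 0" for z
    using D[OF that] assms(1) by (simp add: h_def p_def norm_mult norm_power real_sqrt_mult)
  have h_pow: "h (p ^ n * z) = h z" if "z \<noteq> 0" for z n
    by (induction n) (use h that p in \<open>auto simp: mult.assoc\<close>)
  have h_powi: "h (p powi m * z) = h z" if "z \<noteq> 0" for z m
  proof (cases "m \<ge> 0")
    case True
    then show ?thesis
      using h_pow[OF that] by (simp add: power_int_def)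
  next
    case False
    then have eq: "p ^ nat (- m) * (p powi m * z) = z"
      using p by (simp add: power_int_def field_simps)
    have "h (p ^ nat (- m) * (p powi m * z)) = h (p powi m * z)"
      using p that by (intro h_pow) simp
    then show ?thesis
      unfolding eq ..
  qed
  \<comment> \<open>The closed annulus is compact, and every orbit of multiplication by
    \<open>p\<close> in the punctured plane meets it, so a bound for \<open>h\<close> on it is a
    global one.\<close>
  let ?K = "cball 0 1 - ball 0 (norm p) :: complex set"
  have "continuous_on ?K h"
    unfolding h_def using p
    by (intro continuous_intros continuous_on_subset[OF holomorphic_on_imp_continuous_on[OF hol]]) auto
  moreover have "compact ?K"
    by (intro compact_diff) auto
  ultimately have "bounded (h ` ?K)"
    by (intro compact_imp_bounded compact_continuous_image)
  then obtain C where "\<forall>y\<in>h ` ?K. norm y \<le> C"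
    unfolding bounded_iff by blast
  then have C: "h z \<le> C" if "z \<in> ?K" for z
    using that abs_ge_self[of "h z"] by (auto intro: order_trans)
  have h_le: "h z \<le> C" if z: "z \<noteq> 0" for z
  proof -
    obtain m where "norm p \<le> norm p powi m * norm z" "norm p powi m * norm z \<le> 1"
      using scaling_to_annulus[of "norm p" "norm z"] p z by auto
    then have "h (p powi m * z) \<le> C"
      by (intro C) (auto simp: norm_mult norm_power_int)
    then show ?thesis
      using h_powi[OF z] by simp
  qed
  define \<phi> where "\<phi> w = D (exp w) * exp (- w / 2)" for w
  have "norm (\<phi> w) \<le> C" for w
  proof -
    \<comment> \<open>The factor \<open>exp (- w / 2)\<close> has modulus
      \<open>1 / sqrt (norm (exp w))\<close>, so the modulus of \<phi> is \<open>h\<close> at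
      \<open>exp w\<close>.\<close>
    have "exp (Re w / 2) ^ 2 = exp (Re w)"
      by (simp flip: exp_double)
    then have "sqrt (exp (Re w)) = exp (Re w / 2)"
      by (metis exp_ge_zero real_sqrt_unique)
    then have "norm (\<phi> w) = h (exp w)"
      by (simp add: \<phi>_def h_def norm_mult norm_divide exp_minus field_simps)
    then show ?thesis
      using h_le[of "exp w"] by simp
  qed
  then have "bounded (range \<phi>)"
    by (auto simp: bounded_iff)
  moreover have "\<phi> holomorphic_on UNIV"
    unfolding \<phi>_def
    by (intro holomorphic_intros holomorphic_on_compose_gen[OF _ hol, unfolded o_def]) auto
  ultimately have "\<phi> constant_on UNIV"
    by (intro Liouville_theorem)
  then obtain c where c: "\<And>w. \<phi> w = c"
    by (auto simp: constant_on_def)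
  have "\<phi> (2 * of_real pi * \<i>) = - \<phi> 0"
    by (simp add: \<phi>_def exp_minus)
  then have "c = 0"
    using c by simp
  then have "\<phi> (Ln z) = 0"
    using c by simp
  then show ?thesis
    using \<open>z \<noteq> 0\<close> by (simp add: \<phi>_def)
qed

text \<open>The functional equations of the two sides have inhomogeneous parts \<theta> and its
  negative. Their sum is homogeneous, and \<open>quasiperiodic_eq_0\<close> applies.\<close>

lemma F4_cleared_sum_eq:
  assumes "q \<noteq> 0" "norm q < 1" "z \<noteq> 0"
  shows "(1 - z) * (\<Sum>n. F4_cleared q z n) = - (\<Sum>\<^sub>\<infinity>k\<in>UNIV. lerch_coeff q k * z powi k)"
proof -
  define G where "G z = (\<Sum>n. F4_cleared q z n)" for z
  define S where "S z = (\<Sum>\<^sub>\<infinity>k\<in>UNIV. lerch_coeff q k * z powi k)" for z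
  have "(1 - z) * G z + S z = 0"
  proof (rule quasiperiodic_eq_0[OF assms(1,2) _ _ assms(3), where D = "\<lambda>z. (1 - z) * G z + S z"])
    show "(\<lambda>z. (1 - z) * G z + S z) holomorphic_on - {0}"
      unfolding G_def S_def
      by (intro holomorphic_intros F4_cleared_sum_holomorphic lerch_sum_holomorphic assms)
    fix w :: complex
    assume "w \<noteq> 0"
    from F4_cleared_functional_eq[OF assms(1,2) this] lerch_functional_eq[OF assms(1,2) this]
    have "((1 - w) * G w + (1 - q ^ 2 * w) * G (q ^ 2 * w) / q) + (S w + S (q ^ 2 * w) / q) = 0"
      by (simp add: G_def S_def)
    then show "(1 - q ^ 2 * w) * G (q ^ 2 * w) + S (q ^ 2 * w) = - q * ((1 - w) * G w + S w)"
      using assms(1) by (simp add: field_simps) algebra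
  qed
  then show ?thesis
    by (simp add: G_def S_def eq_neg_iff_add_eq_0)
qed

section \<open>Return from the cleared series to \<open>F4\<close>\<close>

lemma F4_cleared_eq:
  assumes "norm q < 1" "z \<in> F4_domain q"
  shows "F4_cleared q z n = qpochs_inf [z * q, q / z, q ^ 2] (q ^ 2) * F4_term z q n"
proof -
  have "qpochs [z * q, q / z] (q ^ 2) (n + 1) \<noteq> 0"
    using assms by (auto simp: F4_domain_def)
  moreover have "qpoch_inf a (q ^ 2) = qpoch a (q ^ 2) (n + 1) * qpoch_inf (a * (q ^ 2) ^ (n + 1)) (q ^ 2)"
    for a
    by (rule qpoch_inf_split[OF norm_power2_less_1[OF assms(1)]])
  note this[of "z * q"] this[of "q / z"]
  ultimately show ?thesis
    by (simp add: F4_cleared_def F4_term_def qpochs_def qpochs_inf_def field_simps)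
qed

text \<open>The product vanishes exactly when one of its factors does, and
  \<open>qpoch_inf (q ^ 2) (q ^ 2)\<close> is never 0. The poles of \<open>F4\<close> are thus the
  zeros of a holomorphic function.\<close>

lemma theta_nonzero_iff:
  assumes "q \<noteq> 0" "norm q < 1" "z \<noteq> 0"
  shows "qpochs_inf [z * q, q / z, q ^ 2] (q ^ 2) \<noteq> 0 \<longleftrightarrow> z \<in> F4_domain q"
proof
  note p = norm_power2_less_1[OF assms(2)]
  assume "qpochs_inf [z * q, q / z, q ^ 2] (q ^ 2) \<noteq> 0"
  then have "qpoch (z * q) (q ^ 2) (n + 1) \<noteq> 0" "qpoch (q / z) (q ^ 2) (n + 1) \<noteq> 0" for n
    using qpoch_inf_split[OF p, of "z * q" "n + 1"] qpoch_inf_split[OF p, of "q / z" "n + 1"]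
    by (auto simp: qpochs_inf_def)
  then show "z \<in> F4_domain q"
    using assms by (simp add: F4_domain_def qpochs_def)
next
  note p = norm_power2_less_1[OF assms(2)]
  assume "z \<in> F4_domain q"
  then have "qpoch (z * q) (q ^ 2) (Suc n) \<noteq> 0" "qpoch (q / z) (q ^ 2) (Suc n) \<noteq> 0" for n
    by (auto simp: F4_domain_def qpochs_def)
  then have "z * q * (q ^ 2) ^ n \<noteq> 1" "q / z * (q ^ 2) ^ n \<noteq> 1" for n
    unfolding qpoch_Suc by auto
  then have "qpoch_inf (z * q) (q ^ 2) \<noteq> 0" "qpoch_inf (q / z) (q ^ 2) \<noteq> 0"
    by (intro qpoch_inf_nonzero p; blast)+
  then show "qpochs_inf [z * q, q / z, q ^ 2] (q ^ 2) \<noteq> 0"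
    using p by (simp add: qpochs_inf_def qpoch_inf_nonzero_small)
qed

lemma F4_on_domain:
  assumes "q \<noteq> 0" "norm q < 1" "z \<in> F4_domain q"
  shows "summable (F4_term z q)"
    and "qpochs_inf [z * q, q / z, q ^ 2] (q ^ 2) * F4 z q = (\<Sum>n. F4_cleared q z n)"
proof -
  have nz: "qpochs_inf [z * q, q / z, q ^ 2] (q ^ 2) \<noteq> 0"
    using theta_nonzero_iff[OF assms(1,2)] assms(3) by (auto simp: F4_domain_def)
  have "F4_cleared q z = (\<lambda>n. qpochs_inf [z * q, q / z, q ^ 2] (q ^ 2) * F4_term z q n)"
    using F4_cleared_eq[OF assms(2,3)] by (rule ext)
  then have "summable (\<lambda>n. qpochs_inf [z * q, q / z, q ^ 2] (q ^ 2) * F4_term z q n)"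
    using F4_cleared_summable[OF assms(2), of z] by (simp only:)
  then show *: "summable (F4_term z q)"
    using nz by (simp add: summable_cmult_iff)
  show "qpochs_inf [z * q, q / z, q ^ 2] (q ^ 2) * F4 z q = (\<Sum>n. F4_cleared q z n)"
    using * F4_cleared_eq[OF assms(2,3)] by (simp add: F4_def suminf_mult)
qed

text \<open>The function \<theta> is holomorphic on the connected punctured plane and not
  identically zero, so its zeros are isolated.\<close>

lemma eventually_F4_domain:
  assumes "q \<noteq> 0" "norm q < 1" "z \<noteq> 0"
  shows "eventually (\<lambda>w. w \<in> F4_domain q \<and> w \<noteq> 0) (at z)"
proof -
  note p = norm_power2_less_1[OF assms(2)]
  have inf: "(\<lambda>z. qpoch_inf (f z) (q ^ 2)) holomorphic_on - {0}" if "f holomorphic_on - {0}" for f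
    using holomorphic_on_compose_gen[OF that qpoch_inf_holomorphic[OF p]] by (simp add: o_def)
  have "eventually (\<lambda>w. qpochs_inf [w * q, q / w, q ^ 2] (q ^ 2) \<noteq> 0 \<and> w \<in> - {0}) (at z)"
  proof (rule non_zero_neighbour_alt)
    show "(\<lambda>w. qpochs_inf [w * q, q / w, q ^ 2] (q ^ 2)) holomorphic_on - {0}"
      unfolding qpochs_inf_def list.map prod_list.Cons prod_list.Nil
      by (intro holomorphic_intros inf) auto
    \<comment> \<open>The point -1 serves as a witness: all parameters there have norm below
      1.\<close>
    show "qpochs_inf [- 1 * q, q / (- 1), q ^ 2] (q ^ 2) \<noteq> 0"
      using p assms(2) by (simp add: qpochs_inf_def qpoch_inf_nonzero_small)
    show "connected (- {0 :: complex})"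
      using connected_punctured_universe[of "0 :: complex"] by simp
  qed (use assms in auto)
  then show ?thesis
    by eventually_elim (use theta_nonzero_iff[OF assms(1,2)] in auto)
qed

text \<open>At a pole of \<open>F4\<close> the formal product with \<theta> carries only default
  values. The first equality is therefore stated pointwise on \<open>F4_domain\<close> and as a
  limit at every admissible \<open>z\<close>. Summability is asserted separately because
  \<open>infsum\<close> of a non-summable family is 0 by default.\<close>

theorem theorem3p1:
  fixes q z :: complex
  assumes "0 < norm q" and "norm q < 1" and "z \<noteq> 0" and "z \<noteq> 1"
  shows
    "(z \<in> F4_domain q \<longrightarrow>
        summable (F4_term z q) \<and>
        qpochs_inf [z * q, q / z, q ^ 2] (q ^ 2) * F4 z q =
          1 / (1 - z) * (\<Sum>\<^sub>\<infinity>k\<in>UNIV. lerch_coeff q k * z powi (1 - k))) \<and>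
     (((\<lambda>w. qpochs_inf [w * q, q / w, q ^ 2] (q ^ 2) * F4 w q) \<longlongrightarrow>
            1 / (1 - z) * (\<Sum>\<^sub>\<infinity>k\<in>UNIV. lerch_coeff q k * z powi (1 - k))) (at z)) \<and>
     ((\<lambda>k. lerch_coeff q k * z powi (1 - k)) summable_on UNIV) \<and>
     ((\<lambda>k. lerch_coeff q k * z powi k) summable_on UNIV) \<and>
     ((\<lambda>k. lerch_coeff q k * ((z powi (1 - k) - z powi k) / (1 - z))) summable_on {1..}) \<and>
     (1 / (1 - z) * (\<Sum>\<^sub>\<infinity>k\<in>UNIV. lerch_coeff q k * z powi (1 - k)) =
          - (1 / (1 - z)) * (\<Sum>\<^sub>\<infinity>k\<in>UNIV. lerch_coeff q k * z powi k)) \<and>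
     (- (1 / (1 - z)) * (\<Sum>\<^sub>\<infinity>k\<in>UNIV. lerch_coeff q k * z powi k) =
          (\<Sum>\<^sub>\<infinity>k\<in>{1..}. lerch_coeff q k * ((z powi (1 - k) - z powi k) / (1 - z))))"
proof -
  have q: "q \<noteq> 0" "norm q < 1"
    using assms by auto
  define S where "S = (\<Sum>\<^sub>\<infinity>k\<in>UNIV. lerch_coeff q k * z powi k)"
  define f where "f w = (\<Sum>n. lerch_coeff q (int n + 1) * w ^ n)" for w
  note half = lerch_half_sums[OF q assms(3), folded f_def S_def]
  note refl = lerch_reflected_has_sum[OF q assms(3), folded S_def]
  have G: "(\<Sum>n. F4_cleared q z n) = 1 / (1 - z) * - S"
    using F4_cleared_sum_eq[OF q assms(3)] assms(4) by (simp add: S_def field_simps)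
  have "isCont (\<lambda>w. \<Sum>n. F4_cleared q w n) z"
    using holomorphic_on_imp_continuous_on[OF F4_cleared_sum_holomorphic[OF q(2)]] assms(3)
      continuous_on_eq_continuous_at[of "- {0 :: complex}"] by auto
  then have "((\<lambda>w. \<Sum>n. F4_cleared q w n) \<longlongrightarrow> 1 / (1 - z) * - S) (at z)"
    unfolding isCont_def G .
  \<comment> \<open>The cleared series is continuous at \<open>z\<close> even if \<open>z\<close> is
    a pole, and it agrees with \<theta> times \<open>F4\<close> on a punctured
    neighbourhood.\<close>
  moreover have "eventually (\<lambda>w. (\<Sum>n. F4_cleared q w n) =
      qpochs_inf [w * q, q / w, q ^ 2] (q ^ 2) * F4 w q) (at z)"
    using eventually_F4_domain[OF q assms(3)]
    by eventually_elim (use F4_on_domain(2)[OF q] in simp)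
  ultimately have lim: "((\<lambda>w. qpochs_inf [w * q, q / w, q ^ 2] (q ^ 2) * F4 w q) \<longlongrightarrow>
      1 / (1 - z) * - S) (at z)"
    by (rule Lim_transform_eventually)
  \<comment> \<open>The two half sums give \<open>f (inverse z) - z * f z\<close>, which is minus
    the bilateral sum.\<close>
  have "((\<lambda>k. (lerch_coeff q k * z powi (1 - k) + - (lerch_coeff q k * z powi k)) * (1 / (1 - z)))
      has_sum (f (inverse z) + - (z * f z)) * (1 / (1 - z))) {1..}"
    by (intro has_sum_cmult_left has_sum_add has_sum_uminusI half)
  moreover have "(f (inverse z) + - (z * f z)) * (1 / (1 - z)) = - (1 / (1 - z)) * S"
  proof -
    have "f (inverse z) + - (z * f z) = - S"
      using half(4) by simp
    then show ?thesis
      by (simp only:) simp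
  qed
  moreover have "(\<lambda>k. (lerch_coeff q k * z powi (1 - k) + - (lerch_coeff q k * z powi k)) * (1 / (1 - z))) =
      (\<lambda>k. lerch_coeff q k * ((z powi (1 - k) - z powi k) / (1 - z)))"
    by (simp add: algebra_simps diff_divide_distrib)
  ultimately have half_sum: "((\<lambda>k. lerch_coeff q k * ((z powi (1 - k) - z powi k) / (1 - z)))
      has_sum - (1 / (1 - z)) * S) {1..}"
    by simp
  show ?thesis
    unfolding infsumI[OF refl] infsumI[OF half_sum] S_def[symmetric]
    using F4_on_domain[OF q] G lim refl half_sum lerch_summable[OF q assms(3)]
    by (auto simp: summable_on_def)
qed

end
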